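(* Let $G$ be a (finite, loopless) multigraph and let $f$ be a demand function for the line graph $L(G)$ such that each edge $e\in V(L(G))$ with endpoints $u,v$ satisfies $f(e) \leq 1/(\max\{d(u), d(v)\} + \mu(uv))$, where $\mu(uv)$ is the number of edges of $G$ incident to both $u$ and $v$. Then $L(G)$ has an $f$-coloring.
   Context: For a multigraph $G$, $d(v)=\sum_{u\in N(v)}\mu(uv)$ is the number of edges incident to $v$. The line graph $L(G)$ has vertex set $E(G)$, two edges being adjacent when they share an endpoint. A demand function for a graph $H$ is a function $f: V(H)\to [0,1]\cap\mathbb{Q}$. A fractional coloring of $H$ is a function $\phi$ assigning to each vertex a measurable subset of $[0,1]$ such that adjacent vertices receive disjoint sets. An $f$-coloring is a fractional coloring $\phi$ with Lebesgue measure of $\phi(x)$ at least $f(x)$ for every vertex $x$. *)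

theory Defs
  imports "HOL-Analysis.Analysis"
begin

text \<open>A finite loopless multigraph: finite vertex set V, finite edge set E,
  each edge e has a set of exactly two distinct endpoints ends e, contained in V.
  Parallel edges are distinct elements of E with the same endpoints.\<close>
definition loopless_multigraph :: "'v set \<Rightarrow> 'e set \<Rightarrow> ('e \<Rightarrow> 'v set) \<Rightarrow> bool" where
  "loopless_multigraph V E ends \<longleftrightarrow> finite V \<and> finite E \<and>
     (\<forall>e\<in>E. card (ends e) = 2 \<and> ends e \<subseteq> V)"

definition mdeg :: "'e set \<Rightarrow> ('e \<Rightarrow> 'v set) \<Rightarrow> 'v \<Rightarrow> nat" where
  "mdeg E ends v = card {e\<in>E. v \<in> ends e}"

definition edge_mult :: "'e set \<Rightarrow> ('e \<Rightarrow> 'v set) \<Rightarrow> 'v \<Rightarrow> 'v \<Rightarrow> nat" where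
  "edge_mult E ends u v = card {e\<in>E. u \<in> ends e \<and> v \<in> ends e}"

definition line_adj :: "'e set \<Rightarrow> ('e \<Rightarrow> 'v set) \<Rightarrow> 'e \<Rightarrow> 'e \<Rightarrow> bool" where
  "line_adj E ends e e' \<longleftrightarrow> e \<in> E \<and> e' \<in> E \<and> e \<noteq> e' \<and> ends e \<inter> ends e' \<noteq> {}"

definition demand_function :: "'a set \<Rightarrow> ('a \<Rightarrow> real) \<Rightarrow> bool" where
  "demand_function X f \<longleftrightarrow> (\<forall>x\<in>X. f x \<in> \<rat> \<and> 0 \<le> f x \<and> f x \<le> 1)"

definition fractional_coloring :: "'a set \<Rightarrow> ('a \<Rightarrow> 'a \<Rightarrow> bool) \<Rightarrow> ('a \<Rightarrow> real set) \<Rightarrow> bool" where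
  "fractional_coloring X adj \<phi> \<longleftrightarrow>
     (\<forall>x\<in>X. \<phi> x \<subseteq> {0..1} \<and> \<phi> x \<in> sets lebesgue) \<and>
     (\<forall>x\<in>X. \<forall>y\<in>X. adj x y \<longrightarrow> \<phi> x \<inter> \<phi> y = {})"

definition f_coloring :: "'a set \<Rightarrow> ('a \<Rightarrow> 'a \<Rightarrow> bool) \<Rightarrow> ('a \<Rightarrow> real) \<Rightarrow> ('a \<Rightarrow> real set) \<Rightarrow> bool" where
  "f_coloring X adj f \<phi> \<longleftrightarrow> fractional_coloring X adj \<phi> \<and>
     (\<forall>x\<in>X. measure lebesgue (\<phi> x) \<ge> f x)"

end

theory Submission
  imports Defs
begin

text \<open>
  By concavity, the bound on \<open>f\<close> makes every nonempty vertex set \<open>S\<close> span edges of total demand at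
  most \<open>(|S| - 1) / 2\<close>, and every vertex see total demand at most 1. By Edmonds' matching
  polytope theorem \<open>f\<close> is then a convex combination of matchings, and cutting the unit interval
  into pieces according to the coefficients gives the colouring.

  Edmonds' theorem is proved by the induction of Cunningham and Marsh: for integer
  weights \<open>w\<close>, either some vertex lies on every \<open>w\<close>-maximal matching, and the weights of its
  edges are lowered by 1; or none does, and then lowering the weights of a whole component \<open>K\<close> of
  the support of \<open>w\<close> by 1 lowers the maximum by at least \<open>(|K| - 1) / 2\<close>, by Gallai's exchange
  argument. Hence \<open>\<Sum>e. w e * f e\<close> never exceeds the maximum weight of a matching, so
  no hyperplane separates \<open>f\<close> from the matchings.
\<close>

section \<open>Convex hulls of finite point sets and disjoint intervals\<close>

lemma finite_maximizer:
  fixes g :: "'a \<Rightarrow> 'b :: linorder"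
  assumes "finite A" "A \<noteq> {}"
  obtains x where "x \<in> A" "\<And>y. y \<in> A \<Longrightarrow> g y \<le> g x"
  using obtains_MAX[OF assms, of g] assms(1) by (metis Max_ge finite_imageI imageI)

text \<open>Membership in the convex hull of finitely many points of \<open>E \<rightarrow> \<real>\<close> is witnessed by the nearest
  point \<open>g\<close> of the hull: otherwise \<open>x - g\<close> is a separating functional.\<close>
lemma convex_combination_if_not_separated:
  fixes p :: "'i \<Rightarrow> 'e \<Rightarrow> real" and x :: "'e \<Rightarrow> real"
  assumes I: "finite I" "I \<noteq> {}" and "finite E"
    and sep: "\<And>c. \<exists>i\<in>I. (\<Sum>e\<in>E. c e * x e) \<le> (\<Sum>e\<in>E. c e * p i e)"
  obtains l where "\<And>i. i \<in> I \<Longrightarrow> 0 \<le> l i" "sum l I = 1" "\<And>e. e \<in> E \<Longrightarrow> x e = (\<Sum>i\<in>I. l i * p i e)"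
proof -
  \<comment> \<open>Coordinates outside \<open>I\<close> are pinned to 0, so that the simplex is a
    compact subset of the full function space.\<close>
  let ?B = "PiE UNIV (\<lambda>i. if i \<in> I then {0..1::real} else {0})"
  let ?L = "?B \<inter> {l. sum l I = 1}"
  have coord: "continuous_on UNIV (\<lambda>l :: 'i \<Rightarrow> real. l i)" for i
    by simp
  have "compactin (product_topology (\<lambda>_. euclidean) UNIV) ?B"
    by (subst compactin_PiE) auto
  then have "compact ?B"
    by (simp add: euclidean_product_topology)
  moreover have "closed {l :: 'i \<Rightarrow> real. sum l I = 1}"
    by (intro closed_Collect_eq continuous_on_sum coord continuous_on_const)
  ultimately have comp: "compact ?L"
    by (rule compact_Int_closed)
  define g where "g l e = (\<Sum>i\<in>I. l i * p i e)" for l e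
  define h where "h l = (\<Sum>e\<in>E. (x e - g l e)\<^sup>2)" for l
  have "continuous_on ?L h"
    unfolding h_def g_def
    by (rule continuous_on_subset[of UNIV]) (intro continuous_intros coord, simp)
  moreover obtain i0 where "i0 \<in> I" using I by blast
  then have "(\<lambda>i. if i = i0 then 1 else 0) \<in> ?L"
    using I by (auto simp: PiE_iff split: if_splits)
  ultimately obtain l where l: "l \<in> ?L" and min: "\<And>l'. l' \<in> ?L \<Longrightarrow> h l \<le> h l'"
    using continuous_attains_inf[OF comp] by (metis empty_iff)
  have l0: "0 \<le> l i" if "i \<in> I" for i using l that by (auto simp: PiE_iff split: if_splits)
  define c where "c e = x e - g l e" for e
  obtain i where i: "i \<in> I" "(\<Sum>e\<in>E. c e * x e) \<le> (\<Sum>e\<in>E. c e * p i e)"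
    using sep by blast
  define d where "d e = p i e - g l e" for e
  \<comment> \<open>First-order condition at the nearest point: moving a fraction \<open>t\<close>
    of the way towards \<open>p i\<close> cannot decrease the squared distance
    \<open>h\<close>.\<close>
  have le: "2 * (\<Sum>e\<in>E. c e * d e) \<le> t * (\<Sum>e\<in>E. (d e)\<^sup>2)" if t: "0 < t" "t \<le> 1" for t
  proof -
    define l' where "l' j = (1 - t) * l j + (if j = i then t else 0)" for j
    have "sum l' I = 1"
      using l i I by (simp add: l'_def sum.distrib sum_distrib_left[symmetric])
    moreover have nn: "0 \<le> l' j" if "j \<in> I" for j
      using l0 that t by (simp add: l'_def)
    moreover have "l' j \<le> 1" if "j \<in> I" for j
      using member_le_sum[OF that, of l'] nn I \<open>sum l' I = 1\<close> by auto
    moreover have "l' j = 0" if "j \<notin> I" for j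
      using that i l by (auto simp: l'_def PiE_iff split: if_splits)
    ultimately have "l' \<in> ?L" by (auto simp: PiE_iff)
    then have "h l \<le> h l'" by (rule min)
    moreover have "g l' e = g l e + t * d e" for e
    proof -
      have "g l' e = (\<Sum>j\<in>I. (1 - t) * (l j * p j e) + (if j = i then t * p j e else 0))"
        unfolding g_def l'_def by (intro sum.cong) (auto simp: algebra_simps)
      also have "\<dots> = (1 - t) * g l e + t * p i e"
        using i I by (simp add: sum.distrib g_def sum_distrib_left[symmetric])
      finally show ?thesis by (simp add: d_def algebra_simps)
    qed
    then have "h l' = (\<Sum>e\<in>E. (c e - t * d e)\<^sup>2)"
      unfolding h_def c_def by (intro sum.cong) (auto simp: algebra_simps)
    also have "\<dots> = (\<Sum>e\<in>E. (c e)\<^sup>2 - t * (2 * (c e * d e)) + t * (t * (d e)\<^sup>2))"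
      by (intro sum.cong) (auto simp: power2_eq_square algebra_simps)
    also have "\<dots> = h l - t * (2 * (\<Sum>e\<in>E. c e * d e)) + t * (t * (\<Sum>e\<in>E. (d e)\<^sup>2))"
      by (simp add: sum.distrib sum_subtractf h_def c_def sum_distrib_left)
    ultimately have "t * (2 * (\<Sum>e\<in>E. c e * d e)) \<le> t * (t * (\<Sum>e\<in>E. (d e)\<^sup>2))"
      by linarith
    then show ?thesis using t by simp
  qed
  have "(\<Sum>e\<in>E. c e * d e) \<le> 0"
  proof (rule ccontr)
    assume "\<not> ?thesis"
    then have a: "0 < (\<Sum>e\<in>E. c e * d e)" (is "0 < ?a") by simp
    let ?b = "\<Sum>e\<in>E. (d e)\<^sup>2"
    have b: "0 \<le> ?b" by (simp add: sum_nonneg)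
    \<comment> \<open>Small enough that \<open>t * ?b\<close> is at most \<open>?a\<close>; the 1 in
      the denominator covers \<open>?b = 0\<close>.\<close>
    define t where "t = min 1 (?a / (?b + 1))"
    have t: "0 < t" "t \<le> 1" using a b by (auto simp: t_def)
    have "t * ?b \<le> ?a / (?b + 1) * ?b" using b by (intro mult_right_mono) (auto simp: t_def)
    also have "\<dots> \<le> ?a" using a b by (simp add: field_simps)
    finally show False using le[OF t] a by linarith
  qed
  \<comment> \<open>Here \<open>d\<close> is written as \<open>p i - x\<close> plus
    \<open>c\<close>; by the choice of \<open>i\<close> the squared norm of \<open>c\<close> must
    then vanish.\<close>
  moreover have "(\<Sum>e\<in>E. c e * d e) = (\<Sum>e\<in>E. c e * p i e) - (\<Sum>e\<in>E. c e * x e) + (\<Sum>e\<in>E. (c e)\<^sup>2)"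
    by (simp add: sum_subtractf[symmetric] sum.distrib[symmetric] c_def d_def power2_eq_square algebra_simps)
  ultimately have "(\<Sum>e\<in>E. (c e)\<^sup>2) \<le> 0" using i by linarith
  then have "(\<Sum>e\<in>E. (c e)\<^sup>2) = 0" by (simp add: sum_nonneg antisym)
  then have "c e = 0" if "e \<in> E" for e
    using that \<open>finite E\<close> by (simp add: sum_nonneg_eq_0_iff)
  then have "x e = (\<Sum>i\<in>I. l i * p i e)" if "e \<in> E" for e
    using that by (simp add: c_def g_def)
  then show thesis using that[of l] l0 l by blast
qed

text \<open>Intervals of lengths \<open>l i\<close> are laid end to end. They are half-open, so
  neighbours share no point and length 0 gives the empty set.\<close>

lemma disjoint_intervals:
  fixes l :: "'i \<Rightarrow> real"
  assumes "finite I" "\<And>i. i \<in> I \<Longrightarrow> 0 \<le> l i"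
  shows "\<exists>J. (\<forall>i\<in>I. J i \<in> lmeasurable \<and> J i \<subseteq> {0..<sum l I} \<and> measure lebesgue (J i) = l i)
    \<and> disjoint_family_on J I"
  using assms
proof (induction I rule: finite_induct)
  case empty
  show ?case by (simp add: disjoint_family_on_def)
next
  case (insert a I)
  then obtain J where J: "\<And>i. i \<in> I \<Longrightarrow> J i \<in> lmeasurable" "\<And>i. i \<in> I \<Longrightarrow> J i \<subseteq> {0..<sum l I}"
    "\<And>i. i \<in> I \<Longrightarrow> measure lebesgue (J i) = l i" "disjoint_family_on J I"
    by auto
  have nn: "0 \<le> sum l I" "0 \<le> l a" using insert by (auto intro: sum_nonneg)
  let ?J = "J(a := {sum l I..<sum l I + l a})"
  have "J i \<inter> {sum l I..<sum l I + l a} = {}" if "i \<in> I" for i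
    using J(2)[OF that] by fastforce
  moreover have interval: "{sum l I..<sum l I + l a} \<in> lmeasurable"
    by (intro bounded_set_imp_lmeasurable) auto
  ultimately have "disjoint_family_on ?J (insert a I)"
    using J(4) insert.hyps by (auto simp: disjoint_family_on_def)
  moreover have "?J i \<subseteq> {0..<sum l (insert a I)}" if "i \<in> insert a I" for i
  proof (cases "i = a")
    case False
    then have "J i \<subseteq> {0..<sum l I}" using J(2) that by simp
    also have "\<dots> \<subseteq> {0..<sum l (insert a I)}" using nn insert.hyps by auto
    finally show ?thesis using False by simp
  qed (use nn insert.hyps in auto)
  moreover have "?J i \<in> lmeasurable \<and> measure lebesgue (?J i) = l i" if "i \<in> insert a I" for i
    using J(1,3) interval nn that by (cases "i = a") auto
  ultimately show ?case
    by (intro exI[of _ ?J]) blast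
qed

subsection \<open>Exchanging matchings\<close>

locale multigraph =
  fixes E :: "'e set" and ends :: "'e \<Rightarrow> 'v set"
  assumes finite_edges: "finite E"
    and card_ends: "e \<in> E \<Longrightarrow> card (ends e) = 2"
begin

definition matching :: "'e set \<Rightarrow> bool" where
  "matching M \<longleftrightarrow> M \<subseteq> E \<and> (\<forall>e\<in>M. \<forall>e'\<in>M. e \<noteq> e' \<longrightarrow> ends e \<inter> ends e' = {})"

definition inside :: "'e set \<Rightarrow> 'v set \<Rightarrow> 'e set" where
  "inside F S = {e \<in> F. ends e \<subseteq> S}"

abbreviation covered :: "'e set \<Rightarrow> 'v set" where
  "covered M \<equiv> \<Union> (ends ` M)"

lemma matching_empty: "matching {}"
  by (simp add: matching_def)

lemma matching_mono: "matching M \<Longrightarrow> N \<subseteq> M \<Longrightarrow> matching N"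
  unfolding matching_def by (meson subset_eq)

lemma finite_matching: "matching M \<Longrightarrow> finite M"
  using finite_edges finite_subset unfolding matching_def by blast

lemma finite_matchings: "finite (Collect matching)"
  by (rule finite_subset[of _ "Pow E"]) (auto simp: matching_def finite_edges)

lemma finite_ends: "e \<in> E \<Longrightarrow> finite (ends e)"
  using card_ends card.infinite by fastforce

lemma ends_nonempty: "e \<in> E \<Longrightarrow> ends e \<noteq> {}"
  using card_ends by fastforce

lemma finite_covered: "F \<subseteq> E \<Longrightarrow> finite (covered F)"
  using finite_edges finite_ends finite_subset by blast

lemma inside_subset: "inside F S \<subseteq> F"
  by (auto simp: inside_def)

lemma card_covered:
  assumes "matching M"
  shows "card (covered M) = 2 * card M"
proof -
  have "card (covered M) = (\<Sum>e\<in>M. card (ends e))"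
    using assms finite_ends finite_matching[OF assms]
    by (intro card_UN_disjoint) (auto simp: matching_def)
  also have "\<dots> = (\<Sum>e\<in>M. 2)"
    using assms card_ends by (intro sum.cong) (auto simp: matching_def)
  finally show ?thesis by simp
qed

text \<open>The edges of \<open>M\<close> inside \<open>C\<close> cover two vertices each, all
  distinct and all in \<open>C - X\<close>.\<close>

lemma card_matching_inside:
  assumes "matching M" "finite C" "X \<subseteq> C" "X \<inter> covered M = {}"
  shows "2 * card (inside M C) + card X \<le> card C"
proof -
  have m: "matching (inside M C)"
    using assms(1) matching_mono inside_subset by blast
  have "covered (inside M C) \<subseteq> C - X"
    using assms by (auto simp: inside_def)
  then have "card (covered (inside M C)) \<le> card (C - X)"
    using assms by (intro card_mono) auto
  also have "\<dots> = card C - card X"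
    using assms by (meson card_Diff_subset finite_subset)
  finally show ?thesis
    using card_covered[OF m] card_mono[OF assms(2,3)] by linarith
qed

text \<open>A set that is maximal subject to the cardinality bound cannot be left by an edge:
  adding the other endpoint of such an edge would preserve the bound.\<close>
lemma closed_set_with_many_edges:
  assumes "F \<subseteq> E" "finite K" "t \<in> K"
    and K: "\<And>e. e \<in> F \<Longrightarrow> ends e \<subseteq> K \<or> ends e \<inter> K = {}"
  obtains C where "C \<subseteq> K" "t \<in> C" "card C \<le> Suc (card (inside F C))"
    "\<And>e. e \<in> F \<Longrightarrow> ends e \<subseteq> C \<or> ends e \<inter> C = {}"
proof -
  let ?P = "\<lambda>C. C \<subseteq> K \<and> t \<in> C \<and> card C \<le> Suc (card (inside F C))"
  have "finite (Collect ?P)" using assms(2) by auto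
  moreover have "?P {t}" using assms by simp
  ultimately obtain C where C: "?P C" and max: "\<And>C'. ?P C' \<Longrightarrow> C \<subseteq> C' \<Longrightarrow> C' = C"
    using finite_has_maximal[of "Collect ?P"] by (metis (no_types, lifting) empty_iff mem_Collect_eq)
  have "ends e \<subseteq> C \<or> ends e \<inter> C = {}" if e: "e \<in> F" for e
  proof (rule ccontr)
    assume "\<not> ?thesis"
    then obtain x y where xy: "x \<in> ends e" "x \<notin> C" "y \<in> ends e" "y \<in> C" by auto
    have "card (ends e) = 2" using e assms(1) card_ends by auto
    then have ends: "ends e = {x, y}"
      using xy by (auto simp: card_2_iff)
    have "x \<in> K" using K[OF e] xy C by auto
    have fin: "finite F" using assms(1) finite_edges finite_subset by auto
    have "insert e (inside F C) \<subseteq> inside F (insert x C)" "e \<notin> inside F C"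
      using e ends xy by (auto simp: inside_def)
    moreover have "finite (inside F S)" for S
      using fin inside_subset finite_subset by metis
    ultimately have "Suc (card (inside F C)) \<le> card (inside F (insert x C))"
      by (metis card_insert_disjoint card_mono)
    moreover have "card (insert x C) = Suc (card C)"
      using xy C assms(2) finite_subset by (metis card_insert_disjoint)
    ultimately have "?P (insert x C)"
      using C \<open>x \<in> K\<close> by auto
    then show False using max xy by blast
  qed
  then show thesis using that C by blast
qed

text \<open>If no edge of \<open>M \<union> N\<close> leaves \<open>C\<close>, this switches from
  \<open>M\<close> to \<open>N\<close> along the alternating paths and cycles in \<open>C\<close>,
  without having to describe them.\<close>

definition exchange :: "'v set \<Rightarrow> 'e set \<Rightarrow> 'e set \<Rightarrow> 'e set" where
  "exchange C M N = (M - inside M C) \<union> inside N C"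

lemma exchange_matching:
  assumes "matching M" "matching N"
    and C: "\<And>e. e \<in> M \<union> N \<Longrightarrow> ends e \<subseteq> C \<or> ends e \<inter> C = {}"
  shows "matching (exchange C M N)"
  unfolding matching_def
proof (intro conjI ballI impI)
  show "exchange C M N \<subseteq> E"
    using assms by (auto simp: exchange_def inside_def matching_def)
next
  fix e e' assume e: "e \<in> exchange C M N" "e' \<in> exchange C M N" "e \<noteq> e'"
  have M: "x \<in> M \<and> ends x \<inter> C = {} \<or> x \<in> N \<and> ends x \<subseteq> C" if "x \<in> exchange C M N" for x
    using that C by (auto simp: exchange_def inside_def)
  show "ends e \<inter> ends e' = {}"
    using M[OF e(1)] M[OF e(2)] e(3) assms(1,2) unfolding matching_def by blast
qed

text \<open>Added to the same equation with \<open>M\<close> and \<open>N\<close> interchanged, this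
  shows that the two exchanges together preserve the total weight. The additive form avoids
  subtraction in \<open>nat\<close>.\<close>

lemma sum_exchange:
  fixes w :: "'e \<Rightarrow> nat"
  assumes "finite M" "finite N"
  shows "sum w (exchange C M N) + sum w (inside M C) = sum w M + sum w (inside N C)"
proof -
  have disj: "(M - inside M C) \<inter> inside N C = {}"
    by (auto simp: inside_def)
  have "sum w (exchange C M N) = sum w (M - inside M C) + sum w (inside N C)"
    unfolding exchange_def using assms(1,2) disj
    by (intro sum.union_disjoint) (auto simp: inside_def)
  moreover have "sum w M = sum w (M - inside M C) + sum w (inside M C)"
    using assms(1) inside_subset by (metis sum.subset_diff)
  ultimately show ?thesis by simp
qed

text \<open>The exchange moves the uncovered pair \<open>u\<close>, \<open>v\<close> to a pair containing \<open>t\<close>: the component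
  \<open>C\<close> of \<open>t\<close> in \<open>M \<union> N\<close> has at least \<open>card C - 1\<close> edges, so it is too small to
  miss \<open>u\<close> and \<open>v\<close> in \<open>M\<close> and also \<open>t\<close> in \<open>N\<close>.\<close>
lemma exchange_uncovered:
  fixes w :: "'e \<Rightarrow> nat"
  assumes "matching M" "matching N" "finite K" "t \<in> K" "t \<notin> covered N" "u \<noteq> v"
    and "u \<notin> covered M" "v \<notin> covered M"
    and K: "\<And>e. e \<in> M \<union> N \<Longrightarrow> ends e \<subseteq> K \<or> ends e \<inter> K = {}"
  obtains M' N' where "matching M'" "matching N'" "M' \<union> N' \<subseteq> M \<union> N"
    "t \<notin> covered M'" "u \<notin> covered M' \<or> v \<notin> covered M'"
    "sum w M' + sum w N' = sum w M + sum w N"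
    "card (inside M' K) \<le> card (inside M K)"
proof -
  have sub: "M \<union> N \<subseteq> E" and fin: "finite M" "finite N"
    using assms finite_matching by (auto simp: matching_def)
  obtain C where C: "C \<subseteq> K" "t \<in> C" "card C \<le> Suc (card (inside (M \<union> N) C))"
    "\<And>e. e \<in> M \<union> N \<Longrightarrow> ends e \<subseteq> C \<or> ends e \<inter> C = {}"
    using closed_set_with_many_edges[OF sub \<open>finite K\<close> \<open>t \<in> K\<close> K] by metis
  have finC: "finite C" using C assms finite_subset by auto
  have "inside (M \<union> N) C = inside M C \<union> inside N C" by (auto simp: inside_def)
  then have le: "card C \<le> Suc (card (inside M C) + card (inside N C))"
    using C(3) card_Un_le[of "inside M C" "inside N C"] by simp
  have N_le: "2 * card (inside N C) + 1 \<le> card C"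
    using card_matching_inside[of N C "{t}"] assms C finC by auto
  \<comment> \<open>Otherwise \<open>M\<close> misses two vertices of \<open>C\<close> and
    \<open>N\<close> misses one. With m and n edges inside \<open>C\<close>, both 2m + 2 and 2n + 1
    are at most \<open>card C\<close>, which contradicts \<open>card C\<close> being at most m + n +
    1.\<close>
  have uv: "\<not> {u, v} \<subseteq> C"
  proof
    assume "{u, v} \<subseteq> C"
    then have "2 * card (inside M C) + card {u, v} \<le> card C"
      using assms finC by (intro card_matching_inside) auto
    then show False using le N_le \<open>u \<noteq> v\<close> by simp
  qed
  let ?M = "exchange C M N" and ?N = "exchange C N M"
  have cov: "x \<notin> covered ?M" if "x \<notin> covered M" "x \<notin> C" for x
    using that by (auto simp: exchange_def inside_def)
  have "t \<notin> covered ?M"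
    using C(2,4) \<open>t \<notin> covered N\<close> by (fastforce simp: exchange_def inside_def)
  moreover have "u \<notin> covered ?M \<or> v \<notin> covered ?M"
    using uv cov assms by blast
  moreover have "matching ?M" "matching ?N"
    using exchange_matching[of M N C] exchange_matching[of N M C] assms(1,2) C(4) by blast+
  moreover have "?M \<union> ?N \<subseteq> M \<union> N"
    by (auto simp: exchange_def inside_def)
  moreover have "sum w ?M + sum w ?N = sum w M + sum w N"
    using sum_exchange[of M N w C] sum_exchange[of N M w C] fin by simp
  \<comment> \<open>By \<open>le\<close> and \<open>N_le\<close>, \<open>N\<close> has no more edges
    inside \<open>C\<close> than \<open>M\<close>.\<close>
  moreover have "card (inside ?M K) \<le> card (inside M K)"
  proof -
    have "inside ?M K = (inside M K - inside M C) \<union> inside N C"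
      using C(1) by (auto simp: exchange_def inside_def)
    then have "card (inside ?M K) \<le> card (inside M K - inside M C) + card (inside N C)"
      by (simp add: card_Un_le)
    moreover have "inside M C \<subseteq> inside M K" using C(1) by (auto simp: inside_def)
    moreover have "finite (inside M K)" using fin inside_subset finite_subset by metis
    ultimately show ?thesis
      using le N_le card_mono[of "inside M K" "inside M C"]
        card_Diff_subset[of "inside M C" "inside M K"] finite_subset[of "inside M C" "inside M K"]
      by linarith
  qed
  ultimately show thesis using that by blast
qed

text \<open>Among the matchings that maximise the lowered weight \<open>q\<close>, take those with most edges in \<open>K\<close>.
  The relation \<open>sep\<close>, that no such matching misses both of two distinct vertices, is transitive
  by the exchange lemma and holds along edges, hence on all of \<open>K\<close>.\<close>
lemma near_perfect_on_component:
  fixes w :: "'e \<Rightarrow> nat"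
  assumes F: "F \<subseteq> E" and pos: "\<And>e. e \<in> F \<Longrightarrow> 0 < w e"
    and K: "K = {(x, y). \<exists>e\<in>F. x \<in> ends e \<and> y \<in> ends e}\<^sup>* `` {r}" and "finite K"
    and missing: "\<And>t. t \<in> K \<Longrightarrow> \<exists>N\<subseteq>F. matching N \<and> t \<notin> covered N \<and>
          (\<forall>N'\<subseteq>F. matching N' \<longrightarrow> sum w N' \<le> sum w N)"
    and M0: "M0 \<subseteq> F" "matching M0"
  obtains M where "M \<subseteq> F" "matching M"
    "2 * sum w M0 + card K \<le> 2 * sum w M + 2 * card (inside M0 K) + 1"
proof -
  have finF: "finite F" using F finite_edges finite_subset by auto
  have closed: "ends e \<subseteq> K \<or> ends e \<inter> K = {}" if "e \<in> F" for e
    unfolding K using that by (auto intro: rtrancl_into_rtrancl)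
  \<comment> \<open>For matchings in \<open>F\<close> this is the weight after lowering
    \<open>w\<close> by 1 inside \<open>K\<close>; it is an integer to avoid truncated
    subtraction.\<close>
  define q where "q M = int (sum w M) - int (card (inside M K))" for M
  let ?\<M> = "{M. M \<subseteq> F \<and> matching M}"
  have fin: "finite ?\<M>" using finF by simp
  obtain M1 where M1: "M1 \<in> ?\<M>" "\<And>M. M \<in> ?\<M> \<Longrightarrow> q M \<le> q M1"
    using finite_maximizer[OF fin, of q] M0 by (metis (mono_tags, lifting) empty_iff mem_Collect_eq)
  let ?\<Q> = "{M \<in> ?\<M>. q M = q M1}"
  have finQ: "finite ?\<Q>" by (rule finite_subset[OF _ fin]) auto
  obtain M2 where M2: "M2 \<in> ?\<Q>" "\<And>M. M \<in> ?\<Q> \<Longrightarrow> card (inside M K) \<le> card (inside M2 K)"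
    using finite_maximizer[OF finQ, of "\<lambda>M. card (inside M K)"] M1(1)
    by (metis (mono_tags, lifting) empty_iff mem_Collect_eq)
  define good where "good M \<longleftrightarrow> M \<in> ?\<Q> \<and> card (inside M K) = card (inside M2 K)" for M
  have good2: "good M2" using M2 by (simp add: good_def)
  \<comment> \<open>Since \<open>q\<close> is already maximal at \<open>M\<close>, a matching that
    loses no weight and gains no edge in \<open>K\<close> must tie with \<open>M\<close> in
    both.\<close>
  have goodI: "good M'" if "good M" "M' \<subseteq> F" "matching M'" "sum w M \<le> sum w M'"
    "card (inside M' K) \<le> card (inside M K)" for M M'
  proof -
    have "q M' \<le> q M1" using M1 that by simp
    moreover have "q M = q M1" using that by (simp add: good_def)
    ultimately have "q M' = q M1" "card (inside M' K) = card (inside M K)"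
      using that(4,5) unfolding q_def by linarith+
    then show ?thesis using that by (simp add: good_def)
  qed
  \<comment> \<open>The disjunct \<open>x = y\<close> makes the relation reflexive even at a vertex
    that some good matching misses.\<close>
  define sep where "sep x y \<longleftrightarrow> x = y \<or> (\<forall>M. good M \<longrightarrow> x \<in> covered M \<or> y \<in> covered M)" for x y
  have sep_trans: "sep x y" if xt: "sep x t" and ty: "sep t y" and t: "t \<in> K" for x t y
  proof (rule ccontr)
    assume "\<not> sep x y"
    then obtain M where M: "good M" "x \<noteq> y" "x \<notin> covered M" "y \<notin> covered M"
      by (auto simp: sep_def)
    have tM: "x \<noteq> t" "y \<noteq> t" using xt ty \<open>\<not> sep x y\<close> by auto
    obtain N where N: "N \<subseteq> F" "matching N" "t \<notin> covered N"
      "\<And>N'. N' \<subseteq> F \<Longrightarrow> matching N' \<Longrightarrow> sum w N' \<le> sum w N"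
      using missing[OF t] by blast
    have MF: "M \<subseteq> F" "matching M" using M by (auto simp: good_def)
    have cl: "\<And>e. e \<in> M \<union> N \<Longrightarrow> ends e \<subseteq> K \<or> ends e \<inter> K = {}"
      using closed MF N by auto
    obtain M' N' where M': "matching M'" "matching N'" "M' \<union> N' \<subseteq> M \<union> N"
      "t \<notin> covered M'" "x \<notin> covered M' \<or> y \<notin> covered M'"
      "sum w M' + sum w N' = sum w M + sum w N"
      "card (inside M' K) \<le> card (inside M K)"
      using exchange_uncovered[OF MF(2) N(2) \<open>finite K\<close> t N(3) M(2-4) cl] by blast
    have sub: "M' \<subseteq> F" "N' \<subseteq> F" using M'(3) MF N by auto
    \<comment> \<open>As \<open>N\<close> has maximum weight, \<open>M'\<close> is at least as heavy
      as \<open>M\<close>. So \<open>M'\<close> stays good, yet it misses \<open>t\<close> together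
      with \<open>x\<close> or \<open>y\<close>.\<close>
    have "sum w N' \<le> sum w N" using N(4) sub M' by blast
    then have "good M'" using M' sub by (intro goodI[OF M(1)]) auto
    then show False
      using M'(4,5) xt ty tM by (auto simp: sep_def)
  qed
  have sep_edge: "sep x y" if e: "e \<in> F" "x \<in> ends e" "y \<in> ends e" "x \<in> K" for e x y
  proof (rule ccontr)
    assume "\<not> sep x y"
    then obtain M where M: "good M" "x \<noteq> y" "x \<notin> covered M" "y \<notin> covered M"
      by (auto simp: sep_def)
    have MF: "M \<subseteq> F" "matching M" using M by (auto simp: good_def)
    have "card (ends e) = 2" using e F card_ends by auto
    then have ends: "ends e = {x, y}"
      using e M(2) by (auto simp: card_2_iff)
    have eM: "e \<notin> M" using M e by auto
    have eK: "ends e \<subseteq> K" using closed[OF e(1)] e by auto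
    \<comment> \<open>Adding \<open>e\<close> raises the weight by at least 1 and the edge count in
      \<open>K\<close> by exactly 1. So \<open>q\<close> does not fall, against the choice of
      \<open>M2\<close> with most edges in \<open>K\<close>.\<close>
    have m: "matching (insert e M)"
      using MF M F e(1) ends unfolding matching_def by auto
    have finM: "finite M" using MF finite_matching by auto
    have "inside (insert e M) K = insert e (inside M K)" using eK by (auto simp: inside_def)
    moreover have "e \<notin> inside M K" "finite (inside M K)" using eM finM by (auto simp: inside_def)
    ultimately have c: "card (inside (insert e M) K) = Suc (card (inside M K))" by simp
    have s: "sum w (insert e M) = w e + sum w M" using eM finM by simp
    have M_eq: "q M = q M1" using M(1) by (simp add: good_def)
    have "q M \<le> q (insert e M)" using c s pos[OF e(1)] by (simp add: q_def)
    moreover have in\<M>: "insert e M \<in> ?\<M>" using m MF e by auto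
    ultimately have "insert e M \<in> ?\<Q>" using M1(2)[OF in\<M>] M_eq by auto
    then show False using M2(2)[of "insert e M"] c M(1) by (simp add: good_def)
  qed
  have sep_r: "sep r x" if "x \<in> K" for x
  proof -
    have "(r, x) \<in> {(x, y). \<exists>e\<in>F. x \<in> ends e \<and> y \<in> ends e}\<^sup>*" using that K by auto
    then show ?thesis
    proof (induction rule: rtrancl_induct)
      case base show ?case by (simp add: sep_def)
    next
      case (step y z)
      then have "y \<in> K" by (simp add: K)
      then show ?case using step sep_edge sep_trans by blast
    qed
  qed
  have sep_sym: "sep x y \<Longrightarrow> sep y x" for x y by (auto simp: sep_def)
  have rK: "r \<in> K" by (simp add: K)
  have sepK: "sep x y" if "x \<in> K" "y \<in> K" for x y
    using sep_trans[OF sep_sym[OF sep_r] sep_r rK] that by blast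
  have M2': "M2 \<subseteq> F" "matching M2" using M2 by auto
  have uncov: "x = y" if "x \<in> K - covered M2" "y \<in> K - covered M2" for x y
    using sepK[of x y] that good2 by (auto simp: sep_def)
  have "card (K - covered M2) \<le> 1"
    using uncov \<open>finite K\<close> by (subst card_le_Suc0_iff_eq[unfolded One_nat_def[symmetric]]) blast+
  \<comment> \<open>No edge of \<open>F\<close> leaves \<open>K\<close>, so the covered vertices of
    \<open>K\<close> are covered from inside \<open>K\<close>. All but at most one vertex of
    \<open>K\<close> are therefore paired up by \<open>inside M2 K\<close>.\<close>
  moreover have "K \<inter> covered M2 \<subseteq> covered (inside M2 K)"
    using closed M2' by (fastforce simp: inside_def)
  then have "card (K \<inter> covered M2) \<le> card (covered (inside M2 K))"
    using M2' F inside_subset by (intro card_mono finite_covered) blast+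
  moreover have "card (covered (inside M2 K)) = 2 * card (inside M2 K)"
    using M2' matching_mono inside_subset card_covered by blast
  moreover have "card K = card (K \<inter> covered M2) + card (K - covered M2)"
    using \<open>finite K\<close> by (metis card_Int_Diff)
  ultimately have "card K \<le> 2 * card (inside M2 K) + 1" by linarith
  moreover have "q M0 \<le> q M2" using M2 M1(2)[of M0] M0 by auto
  ultimately have "2 * sum w M0 + card K \<le> 2 * sum w M2 + 2 * card (inside M0 K) + 1"
    unfolding q_def by linarith
  then show thesis using that M2' by blast
qed

section \<open>Edmonds' inequality for natural weights\<close>

text \<open>Each induction step lowers weights so that the maximum weight of a matching falls at
  least as much as the left side. The bound \<open>subgraph\<close> covers sets of either parity, so
  the component chosen below need not be shown to be odd.\<close>

lemma weight_le_matching_weight: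
  fixes w :: "'e \<Rightarrow> nat" and f :: "'e \<Rightarrow> real"
  assumes nonneg: "\<And>e. e \<in> E \<Longrightarrow> 0 \<le> f e"
    and vertex: "\<And>v. (\<Sum>e | e \<in> E \<and> v \<in> ends e. f e) \<le> 1"
    and subgraph: "\<And>S. finite S \<Longrightarrow> S \<noteq> {} \<Longrightarrow> (\<Sum>e\<in>inside E S. f e) \<le> (real (card S) - 1) / 2"
  shows "\<exists>M. matching M \<and> (\<Sum>e\<in>E. real (w e) * f e) \<le> real (sum w M)"
proof (induction "sum w E" arbitrary: w rule: less_induct)
  case less
  define F where "F = {e \<in> E. 0 < w e}"
  have F: "F \<subseteq> E" by (auto simp: F_def)
  then have finF: "finite F" using finite_edges finite_subset by auto
  have restrict: "matching (M \<inter> F)" "sum w (M \<inter> F) = sum w M" if "matching M" for M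
    using that matching_mono[of M "M \<inter> F"] finite_matching[OF that]
    by (auto simp: F_def matching_def intro!: sum.mono_neutral_left)
  \<comment> \<open>Both cases below lower the weight by 1 on the edges of a nonempty set \<open>D\<close>.\<close>
  have step: "\<exists>M. matching M \<and> (\<Sum>e\<in>E. real (w e) * f e) \<le> real (sum w M)"
    if D: "D \<subseteq> F" "D \<noteq> {}" and b: "sum f D \<le> b"
      and max: "\<And>M. M \<subseteq> F \<Longrightarrow> matching M \<Longrightarrow>
        \<exists>M'. matching M' \<and> real (sum w M) + b \<le> real (sum w M') + real (card (M \<inter> D))" for D b
  proof -
    define w' where "w' e = (if e \<in> D then w e - 1 else w e)" for e
    have w: "w e = w' e + (if e \<in> D then 1 else 0)" for e
      using D by (auto simp: w'_def F_def)
    have ind: "sum w A = sum w' A + card (A \<inter> D)" if "finite A" for A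
      using that by (simp add: w sum.distrib sum.If_cases)
    have "E \<inter> D \<noteq> {}" using D F by auto
    then have "sum w' E < sum w E"
      using ind[OF finite_edges] finite_edges by (simp add: card_gt_0_iff)
    then obtain M where M: "matching M" "(\<Sum>e\<in>E. real (w' e) * f e) \<le> real (sum w' M)"
      using less by blast
    have MF: "M \<inter> F \<subseteq> F" "matching (M \<inter> F)" using restrict M by auto
    obtain M' where M': "matching M'"
      "real (sum w (M \<inter> F)) + b \<le> real (sum w M') + real (card (M \<inter> F \<inter> D))"
      using max[OF MF] by blast
    have "(\<Sum>e\<in>E. real (w e) * f e) = (\<Sum>e\<in>E. real (w' e) * f e) + (\<Sum>e\<in>E. if e \<in> D then f e else 0)"
      by (simp add: w sum.distrib[symmetric] algebra_simps) (rule sum.cong, auto)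
    also have "(\<Sum>e\<in>E. if e \<in> D then f e else 0) = sum f D"
      using D F finite_edges by (simp add: sum.If_cases Int_absorb1)
    finally have "(\<Sum>e\<in>E. real (w e) * f e) \<le> real (sum w' M) + b"
      using M b by linarith
    also have "\<dots> = real (sum w (M \<inter> F)) - real (card (M \<inter> D)) + b"
      using restrict(2)[OF M(1)] ind[OF finite_matching[OF M(1)]] by simp
    also have "M \<inter> D = M \<inter> F \<inter> D" using D by auto
    finally show ?thesis using M' by auto
  qed
  show ?case
  proof (cases "F = {}")
    case True
    then have "(\<Sum>e\<in>E. real (w e) * f e) = 0" by (auto simp: F_def)
    then show ?thesis using matching_empty by (intro exI[of _ "{}"]) simp
  next
    case False
    let ?max = "\<lambda>N. N \<subseteq> F \<and> matching N \<and> (\<forall>N'\<subseteq>F. matching N' \<longrightarrow> sum w N' \<le> sum w N)"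
    let ?\<M> = "{N. N \<subseteq> F \<and> matching N}"
    have "finite ?\<M>" "?\<M> \<noteq> {}" using finF matching_empty by auto
    then obtain N where "N \<in> ?\<M>" "\<And>N'. N' \<in> ?\<M> \<Longrightarrow> sum w N' \<le> sum w N"
      using finite_maximizer[of ?\<M> "sum w"] by metis
    then have N: "?max N" by simp
    show ?thesis
    proof (cases "\<exists>u\<in>covered F. \<forall>N. ?max N \<longrightarrow> u \<in> covered N")
      case True
      then obtain u where u: "u \<in> covered F" "\<And>N. ?max N \<Longrightarrow> u \<in> covered N" by blast
      let ?D = "{e \<in> F. u \<in> ends e}"
      show ?thesis
      proof (rule step[of ?D 1])
        show "?D \<subseteq> F" "?D \<noteq> {}" using u by auto
        have "sum f ?D \<le> (\<Sum>e | e \<in> E \<and> u \<in> ends e. f e)"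
          using F finite_edges nonneg by (intro sum_mono2) auto
        then show "sum f ?D \<le> 1" using vertex[of u] by linarith
        fix M assume M: "M \<subseteq> F" "matching M"
        \<comment> \<open>A matching that covers \<open>u\<close> has an edge in \<open>?D\<close>
          to pay for the 1. A matching that misses \<open>u\<close> is not of maximum weight, and
          integrality makes it lighter than \<open>N\<close> by at least 1.\<close>
        have "sum w M + 1 \<le> sum w N + card (M \<inter> ?D)"
        proof (cases "u \<in> covered M")
          case True
          then have "M \<inter> ?D \<noteq> {}" using M by auto
          then have "card (M \<inter> ?D) \<ge> 1"
            using finF by (metis (no_types, lifting) card_gt_0_iff finite_Int finite_matching M(2) One_nat_def Suc_leI)
          then show ?thesis using N M by (metis add_mono)
        next
          case False
          then have "\<not> ?max M" using u(2) by blast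
          then obtain N' where "N' \<subseteq> F" "matching N'" "sum w M < sum w N'"
            using M by (meson not_le)
          moreover from this have "sum w N' \<le> sum w N" using N by blast
          ultimately show ?thesis by linarith
        qed
        then have "real (sum w M) + 1 \<le> real (sum w N) + real (card (M \<inter> ?D))"
          by linarith
        then show "\<exists>M'. matching M' \<and> real (sum w M) + 1 \<le> real (sum w M') + real (card (M \<inter> ?D))"
          using N by blast
      qed
    next
      case False
      obtain e r where e: "e \<in> F" "r \<in> ends e"
        using \<open>F \<noteq> {}\<close> F ends_nonempty by blast
      define K where "K = {(x, y). \<exists>e\<in>F. x \<in> ends e \<and> y \<in> ends e}\<^sup>* `` {r}"
      have sub: "K \<subseteq> covered F"
      proof
        fix x assume "x \<in> K"
        then have "(r, x) \<in> {(x, y). \<exists>e\<in>F. x \<in> ends e \<and> y \<in> ends e}\<^sup>*" by (simp add: K_def)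
        then show "x \<in> covered F" by (cases rule: rtranclE) (use e in auto)
      qed
      then have finK: "finite K" using finite_covered[OF F] finite_subset by blast
      have "r \<in> K" by (simp add: K_def)
      have eK: "e \<in> inside F K"
        using e by (auto simp: inside_def K_def)
      show ?thesis
      proof (rule step[of "inside F K" "(real (card K) - 1) / 2"])
        show "inside F K \<subseteq> F" "inside F K \<noteq> {}" using inside_subset eK by auto
        have "sum f (inside F K) \<le> sum f (inside E K)"
          using F finite_edges nonneg by (intro sum_mono2) (auto simp: inside_def)
        then show "sum f (inside F K) \<le> (real (card K) - 1) / 2"
          using subgraph[OF finK] \<open>r \<in> K\<close> by fastforce
        fix M assume M: "M \<subseteq> F" "matching M"
        have miss: "\<exists>N\<subseteq>F. matching N \<and> t \<notin> covered N \<and> (\<forall>N'\<subseteq>F. matching N' \<longrightarrow> sum w N' \<le> sum w N)"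
          if "t \<in> K" for t
        proof -
          have "t \<in> covered F" using that sub by (rule subsetD[rotated])
          then obtain N where "?max N" "t \<notin> covered N" using False by meson
          then show ?thesis by meson
        qed
        have pos: "0 < w e" if "e \<in> F" for e using that by (simp add: F_def)
        obtain M' where M': "M' \<subseteq> F" "matching M'"
          "2 * sum w M + card K \<le> 2 * sum w M' + 2 * card (inside M K) + 1"
          by (rule near_perfect_on_component[OF F pos K_def finK miss M])
        have "inside M K = M \<inter> inside F K" using M by (auto simp: inside_def)
        moreover have "real (sum w M) + (real (card K) - 1) / 2 \<le> real (sum w M') + real (card (inside M K))"
          using of_nat_mono[OF M'(3), where 'a = real] by (simp add: field_simps)
        ultimately have "real (sum w M) + (real (card K) - 1) / 2
            \<le> real (sum w M') + real (card (M \<inter> inside F K))"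
          by simp
        then show "\<exists>M'. matching M' \<and> real (sum w M) + (real (card K) - 1) / 2
            \<le> real (sum w M') + real (card (M \<inter> inside F K))"
          using M' by blast
      qed
    qed
  qed
qed

subsection \<open>Edge colourings from the matching polytope\<close>

text \<open>A separating functional has real coefficients, possibly negative. It is reduced to
  natural weights by taking positive parts, scaling and rounding up.\<close>

lemma matching_decomposition:
  fixes f :: "'e \<Rightarrow> real"
  assumes nonneg: "\<And>e. e \<in> E \<Longrightarrow> 0 \<le> f e"
    and vertex: "\<And>v. (\<Sum>e | e \<in> E \<and> v \<in> ends e. f e) \<le> 1"
    and subgraph: "\<And>S. finite S \<Longrightarrow> S \<noteq> {} \<Longrightarrow> (\<Sum>e\<in>inside E S. f e) \<le> (real (card S) - 1) / 2"
  obtains l where "\<And>M. matching M \<Longrightarrow> 0 \<le> l M" "(\<Sum>M | matching M. l M) = (1::real)"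
    "\<And>e. e \<in> E \<Longrightarrow> f e = (\<Sum>M | matching M \<and> e \<in> M. l M)"
proof -
  have real_weights: "\<exists>M. matching M \<and> (\<Sum>e\<in>E. c e * f e) \<le> sum c M" for c :: "'e \<Rightarrow> real"
  proof (rule ccontr)
    assume contr: "\<nexists>M. matching M \<and> (\<Sum>e\<in>E. c e * f e) \<le> sum c M"
    \<comment> \<open>Deleting the edges of negative weight leaves a matching, so passing to
      \<open>c'\<close> does not raise the maximum over matchings, while the sum against
      \<open>f\<close> can only grow.\<close>
    define c' where "c' e = max 0 (c e)" for e
    obtain M where M: "matching M" "\<And>N. matching N \<Longrightarrow> sum c N \<le> sum c M"
      using finite_maximizer[OF finite_matchings, of "sum c"] matching_empty
      by (metis empty_iff mem_Collect_eq)
    have pos: "sum c' N \<le> sum c M" if "matching N" for N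
    proof -
      have "sum c' N = sum c {e \<in> N. 0 \<le> c e}"
        using finite_matching[OF that] by (subst sum.inter_filter) (auto simp: c'_def max_def intro: sum.cong)
      also have "\<dots> \<le> sum c M"
        using that by (intro M(2) matching_mono[OF that]) auto
      finally show ?thesis .
    qed
    have "(\<Sum>e\<in>E. c e * f e) \<le> (\<Sum>e\<in>E. c' e * f e)"
      using nonneg by (intro sum_mono mult_right_mono) (auto simp: c'_def)
    then have gap: "sum c M < (\<Sum>e\<in>E. c' e * f e)"
      using contr M by force
    \<comment> \<open>Rounding up costs at most 1 per edge whatever \<open>n\<close> is, so a
      positive gap is impossible for large \<open>n\<close>.\<close>
    have "real n * ((\<Sum>e\<in>E. c' e * f e) - sum c M) \<le> real (card E)" for n
    proof -
      define w where "w e = nat \<lceil>real n * c' e\<rceil>" for e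
      have w: "real n * c' e \<le> real (w e)" "real (w e) \<le> real n * c' e + 1" for e
      proof -
        have "0 \<le> real n * c' e" by (simp add: c'_def)
        then show "real n * c' e \<le> real (w e)" "real (w e) \<le> real n * c' e + 1"
          unfolding w_def by linarith+
      qed
      obtain N where N: "matching N" "(\<Sum>e\<in>E. real (w e) * f e) \<le> real (sum w N)"
        using weight_le_matching_weight[OF nonneg vertex subgraph] by blast
      have "real n * (\<Sum>e\<in>E. c' e * f e) \<le> (\<Sum>e\<in>E. real (w e) * f e)"
        unfolding sum_distrib_left mult.assoc[symmetric]
        using w nonneg by (intro sum_mono mult_right_mono) auto
      also have "\<dots> \<le> (\<Sum>e\<in>N. real (w e))" using N by simp
      also have "\<dots> \<le> (\<Sum>e\<in>N. real n * c' e + 1)"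
        using w by (intro sum_mono) auto
      also have "\<dots> = real n * sum c' N + real (card N)"
        by (simp add: sum.distrib sum_distrib_left)
      also have "\<dots> \<le> real n * sum c M + real (card E)"
        using pos[OF N(1)] N(1) finite_edges
        by (intro add_mono mult_left_mono) (auto simp: matching_def card_mono)
      finally show ?thesis by (simp add: algebra_simps)
    qed
    then show False
      using gap reals_Archimedean3[of "(\<Sum>e\<in>E. c' e * f e) - sum c M"] by (meson diff_gt_0_iff_gt not_less)
  qed
  have ind: "(\<Sum>e\<in>E. c e * of_bool (e \<in> M)) = sum c M" if "matching M" for c :: "'e \<Rightarrow> real" and M
    using that finite_edges by (simp add: of_bool_def if_distrib sum.If_cases matching_def Int_absorb1 cong: if_cong)
  obtain l where l: "\<And>M. M \<in> Collect matching \<Longrightarrow> 0 \<le> l M" "sum l (Collect matching) = (1::real)"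
    "\<And>e. e \<in> E \<Longrightarrow> f e = (\<Sum>M\<in>Collect matching. l M * of_bool (e \<in> M))"
  proof -
    have "finite (Collect matching)" "Collect matching \<noteq> {}"
      using finite_matchings matching_empty by auto
    moreover have "\<exists>M\<in>Collect matching. (\<Sum>e\<in>E. c e * f e) \<le> (\<Sum>e\<in>E. c e * of_bool (e \<in> M))" for c
      using real_weights[of c] ind by auto
    ultimately show thesis
      using that by (rule convex_combination_if_not_separated[OF _ _ finite_edges])
  qed
  show thesis
  proof (rule that)
    show "f e = (\<Sum>M | matching M \<and> e \<in> M. l M)" if "e \<in> E" for e
    proof -
      have "f e = (\<Sum>M\<in>Collect matching. if e \<in> M then l M else 0)"
        unfolding l(3)[OF that] by (rule sum.cong) auto
      also have "\<dots> = (\<Sum>M\<in>{M \<in> Collect matching. e \<in> M}. l M)"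
        by (rule sum.inter_filter[OF finite_matchings, symmetric])
      finally show ?thesis by simp
    qed
  qed (use l in auto)
qed

text \<open>Each matching owns a piece of the unit interval of length \<open>l M\<close>, and an
  edge receives the pieces of all matchings containing it. Adjacent edges lie in no common
  matching.\<close>

lemma coloring_of_matching_decomposition:
  assumes l: "\<And>M. matching M \<Longrightarrow> 0 \<le> l M" "(\<Sum>M | matching M. l M) = 1"
    and f: "\<And>e. e \<in> E \<Longrightarrow> f e = (\<Sum>M | matching M \<and> e \<in> M. l M)"
  shows "\<exists>\<phi>. f_coloring E (line_adj E ends) f \<phi>"
proof -
  obtain J :: "'e set \<Rightarrow> real set"
    where J: "\<And>M. matching M \<Longrightarrow> J M \<in> lmeasurable" "\<And>M. matching M \<Longrightarrow> J M \<subseteq> {0..<1}"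
    "\<And>M. matching M \<Longrightarrow> measure lebesgue (J M) = l M" "disjoint_family_on J (Collect matching)"
  proof -
    have "\<And>M. M \<in> Collect matching \<Longrightarrow> 0 \<le> l M" using l(1) by simp
    from disjoint_intervals[OF finite_matchings this] obtain J where
      "(\<forall>M\<in>Collect matching. J M \<in> lmeasurable \<and> J M \<subseteq> {0..<sum l (Collect matching)} \<and>
        measure lebesgue (J M) = l M) \<and> disjoint_family_on J (Collect matching)" ..
    then show thesis using that[of J] l(2) by simp
  qed
  define \<phi> where "\<phi> e = (\<Union>M\<in>{M. matching M \<and> e \<in> M}. J M)" for e
  have fin: "finite {M. matching M \<and> e \<in> M}" for e
    by (rule finite_subset[OF _ finite_matchings]) auto
  have "\<phi> e \<subseteq> {0..1}" for e
    using J(2) by (fastforce simp: \<phi>_def)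
  moreover have "\<phi> e \<in> sets lebesgue" for e
    unfolding \<phi>_def using J(1) fin by (intro sets.finite_UN) auto
  moreover have "measure lebesgue (\<phi> e) = (\<Sum>M | matching M \<and> e \<in> M. l M)" for e
  proof -
    have "measure lebesgue (\<phi> e) = (\<Sum>M | matching M \<and> e \<in> M. measure lebesgue (J M))"
      unfolding \<phi>_def using J(1,4) fin
      by (intro measure_UNION') (auto simp: disjoint_family_on_def pairwise_def disjnt_def)
    then show ?thesis using J(3) by simp
  qed
  moreover have "\<phi> e \<inter> \<phi> e' = {}" if "line_adj E ends e e'" for e e'
  proof (rule ccontr)
    assume "\<phi> e \<inter> \<phi> e' \<noteq> {}"
    then obtain M M' where M: "matching M" "e \<in> M" "matching M'" "e' \<in> M'" "J M \<inter> J M' \<noteq> {}"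
      by (auto simp: \<phi>_def)
    then have "M = M'" using J(4) by (auto simp: disjoint_family_on_def)
    then show False using M that by (auto simp: matching_def line_adj_def)
  qed
  ultimately have "f_coloring E (line_adj E ends) f \<phi>"
    using f by (simp add: f_coloring_def fractional_coloring_def)
  then show ?thesis by blast
qed

subsection \<open>The local demand bound\<close>

text \<open>This attaches the multiplicity to the edge itself, as the size of its parallel class,
  which suits sums over edges.\<close>

lemma edge_mult_ends:
  assumes "e \<in> E" "ends e = {u, v}"
  shows "edge_mult E ends u v = card {e' \<in> E. ends e' = {u, v}}"
proof -
  have uv: "u \<noteq> v" using card_ends[OF assms(1)] assms(2) by auto
  have "u \<in> ends e' \<and> v \<in> ends e' \<longleftrightarrow> ends e' = {u, v}" if "e' \<in> E" for e'
    using card_ends[OF that] uv by (auto simp: card_2_iff)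
  then show ?thesis unfolding edge_mult_def by (intro arg_cong[of _ _ card]) blast
qed

text \<open>Since \<open>m \<mapsto> m / (d + m)\<close> is concave and at most \<open>k\<close> neighbours share the degree \<open>d\<close>, the worst
  case is \<open>m = d / k\<close>; the proof uses the tangent at that point.\<close>
lemma sum_reciprocals_at_vertex:
  assumes "finite S" "v \<in> S"
  shows "(\<Sum>e | e \<in> inside E S \<and> v \<in> ends e.
      1 / (real (mdeg E ends v) + real (card {e' \<in> E. ends e' = ends e}))) \<le> 1 - 1 / real (card S)"
proof -
  define d where "d = real (mdeg E ends v)"
  define m where "m u = real (card {e \<in> E. ends e = {u, v}})" for u
  define T where "T = S - {v}"
  define k where "k = real (card T)"
  have finT: "finite T" using assms by (simp add: T_def)
  have cardS: "real (card S) = k + 1"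
    using assms by (simp add: k_def T_def card_Diff_singleton) (metis One_nat_def Suc_pred card_gt_0_iff empty_iff of_nat_Suc add.commute)
  have D: "{e. e \<in> inside E S \<and> v \<in> ends e} = (\<Union>u\<in>T. {e \<in> E. ends e = {u, v}})" (is "?D = _")
  proof (intro equalityI subsetI)
    fix e assume e: "e \<in> ?D"
    then have "card (ends e) = 2" using card_ends by (auto simp: inside_def)
    then obtain a b where "ends e = {a, b}" "a \<noteq> b" by (auto simp: card_2_iff)
    then show "e \<in> (\<Union>u\<in>T. {e \<in> E. ends e = {u, v}})"
      using e by (auto simp: inside_def T_def)
  qed (use assms in \<open>auto simp: inside_def T_def\<close>)
  have disj: "\<forall>u\<in>T. \<forall>u'\<in>T. u \<noteq> u' \<longrightarrow> {e \<in> E. ends e = {u, v}} \<inter> {e \<in> E. ends e = {u', v}} = {}"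
    by (auto simp: doubleton_eq_iff T_def)
  have fin: "\<forall>u\<in>T. finite {e \<in> E. ends e = {u, v}}" using finite_edges by simp
  have "sum m T = real (card ?D)"
    unfolding D using card_UN_disjoint[OF finT fin disj] by (simp add: m_def)
  also have "\<dots> \<le> d"
    unfolding d_def mdeg_def using finite_edges
    by (intro of_nat_mono card_mono) (auto simp: inside_def)
  finally have m_le: "sum m T \<le> d" .
  have m0: "0 \<le> m u" for u by (simp add: m_def)
  have "(\<Sum>e\<in>?D. 1 / (d + real (card {e' \<in> E. ends e' = ends e})))
      = (\<Sum>u\<in>T. \<Sum>e | e \<in> E \<and> ends e = {u, v}. 1 / (d + real (card {e' \<in> E. ends e' = ends e})))"
    unfolding D by (rule sum.UNION_disjoint[OF finT fin disj])
  \<comment> \<open>The \<open>m u\<close> parallel edges between \<open>u\<close> and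
    \<open>v\<close> contribute equal terms.\<close>
  also have "\<dots> = (\<Sum>u\<in>T. m u / (d + m u))"
    by (intro sum.cong) (auto simp: m_def)
  also have "\<dots> \<le> 1 - 1 / (k + 1)"
  \<comment> \<open>The tangent at \<open>d / k\<close> requires positive \<open>k\<close> and
    \<open>d\<close>; in the degenerate case the sum is 0.\<close>
  proof (cases "T = {} \<or> d = 0")
    case True
    then have "(\<Sum>u\<in>T. m u / (d + m u)) = 0"
    proof
      assume "d = 0"
      then have "\<forall>u\<in>T. m u = 0" using m_le m0 finT by (metis antisym sum_nonneg sum_nonneg_eq_0_iff)
      then show ?thesis by simp
    qed simp
    then show ?thesis by (simp add: k_def)
  next
    case False
    have k: "0 < k" using False finT by (simp add: k_def card_gt_0_iff)
    have d: "0 < d" using False by (simp add: d_def)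
    have tangent: "m u / (d + m u) \<le> 1 / (k + 1)^2 + k\<^sup>2 / (d * (k + 1)\<^sup>2) * m u" for u
    proof -
      \<comment> \<open>After clearing denominators, the tangent line minus the function is exactly
        this square.\<close>
      have "0 \<le> (k * m u - d)\<^sup>2" by simp
      then have "m u * (d * (k + 1)\<^sup>2) \<le> (d + k\<^sup>2 * m u) * (d + m u)"
        by (simp add: power2_eq_square algebra_simps)
      moreover have "1 / (k + 1)^2 + k\<^sup>2 / (d * (k + 1)\<^sup>2) * m u = (d + k\<^sup>2 * m u) / (d * (k + 1)\<^sup>2)"
        using d k by (simp add: add_divide_distrib)
      moreover have "0 < d + m u" "0 < d * (k + 1)\<^sup>2" using d k m0[of u] by (auto intro: add_pos_nonneg)
      ultimately show ?thesis by (simp add: pos_divide_le_eq pos_le_divide_eq)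
    qed
    have "(\<Sum>u\<in>T. m u / (d + m u)) \<le> (\<Sum>u\<in>T. 1 / (k + 1)^2 + k\<^sup>2 / (d * (k + 1)\<^sup>2) * m u)"
      by (intro sum_mono tangent)
    also have "\<dots> = k * (1 / (k + 1)^2) + k\<^sup>2 / (d * (k + 1)\<^sup>2) * sum m T"
      by (simp add: sum.distrib sum_distrib_left k_def)
    also have "\<dots> \<le> k * (1 / (k + 1)^2) + k\<^sup>2 / (d * (k + 1)\<^sup>2) * d"
      using d k m_le by (intro add_left_mono mult_left_mono) auto
    also have "\<dots> = (k * (k + 1)) / (k + 1)\<^sup>2"
    proof -
      have "k\<^sup>2 / (d * (k + 1)\<^sup>2) * d = k\<^sup>2 / (k + 1)\<^sup>2" using d by simp
      then show ?thesis by (simp add: power2_eq_square add_divide_distrib[symmetric] algebra_simps)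
    qed
    also have "\<dots> = k / (k + 1)"
      using k by (simp add: power2_eq_square)
    also have "\<dots> = 1 - 1 / (k + 1)"
      using k by (simp add: field_simps)
    finally show ?thesis .
  qed
  finally show ?thesis using cardS by (simp add: d_def)
qed

text \<open>Double counting: the maximum of the degrees bounds \<open>2 * f e\<close> by one
  reciprocal per endpoint. Regrouped by vertices, each vertex of \<open>S\<close> contributes at
  most \<open>1 - 1 / card S\<close>.\<close>

lemma demand_inside_le:
  assumes demand: "\<And>e u v. e \<in> E \<Longrightarrow> ends e = {u, v} \<Longrightarrow>
      f e \<le> 1 / (real (max (mdeg E ends u) (mdeg E ends v)) + real (edge_mult E ends u v))"
    and "finite S" "S \<noteq> {}"
  shows "(\<Sum>e\<in>inside E S. f e) \<le> (real (card S) - 1) / 2"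
proof -
  define \<mu> where "\<mu> e = real (card {e' \<in> E. ends e' = ends e})" for e
  have fin: "finite (inside E S)" using finite_edges inside_subset finite_subset by metis
  have f: "2 * f e \<le> (\<Sum>v\<in>ends e. 1 / (real (mdeg E ends v) + \<mu> e))" if e: "e \<in> E" for e
  proof -
    obtain u v where uv: "ends e = {u, v}" "u \<noteq> v"
      using card_ends[OF e] by (auto simp: card_2_iff)
    have "card {e' \<in> E. ends e' = ends e} > 0" using e finite_edges by (auto simp: card_gt_0_iff)
    then have pos: "0 < \<mu> e" by (simp add: \<mu>_def)
    have "f e \<le> 1 / (real (max (mdeg E ends u) (mdeg E ends v)) + \<mu> e)"
      using demand[OF e uv(1)] edge_mult_ends[OF e uv(1)] uv(1) by (simp add: \<mu>_def)
    moreover have "1 / (real (max (mdeg E ends u) (mdeg E ends v)) + \<mu> e) \<le> 1 / (real (mdeg E ends x) + \<mu> e)"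
      if "x \<in> {u, v}" for x
      using that pos by (intro divide_left_mono mult_pos_pos add_nonneg_pos) auto
    ultimately have "f e \<le> 1 / (real (mdeg E ends x) + \<mu> e)" if "x \<in> {u, v}" for x
      using that by (meson order_trans)
    from this[of u] this[of v] show ?thesis using uv by simp
  qed
  have "2 * (\<Sum>e\<in>inside E S. f e) \<le> (\<Sum>e\<in>inside E S. \<Sum>v\<in>ends e. 1 / (real (mdeg E ends v) + \<mu> e))"
    unfolding sum_distrib_left using f inside_subset by (intro sum_mono) blast
  also have "\<dots> = (\<Sum>e\<in>inside E S. \<Sum>v | v \<in> S \<and> v \<in> ends e. 1 / (real (mdeg E ends v) + \<mu> e))"
    by (intro sum.cong) (auto simp: inside_def)
  also have "\<dots> = (\<Sum>v\<in>S. \<Sum>e | e \<in> inside E S \<and> v \<in> ends e. 1 / (real (mdeg E ends v) + \<mu> e))"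
    using fin \<open>finite S\<close> by (rule sum.swap_restrict)
  also have "\<dots> \<le> (\<Sum>v\<in>S. 1 - 1 / real (card S))"
    unfolding \<mu>_def using sum_reciprocals_at_vertex \<open>finite S\<close> by (intro sum_mono) blast
  also have "\<dots> = real (card S) - 1"
    using assms(2,3) by (simp add: field_simps)
  finally show ?thesis by simp
qed

text \<open>Each edge at \<open>v\<close> has demand at most the reciprocal of the degree of
  \<open>v\<close>.\<close>

lemma demand_at_vertex_le:
  assumes demand: "\<And>e u v. e \<in> E \<Longrightarrow> ends e = {u, v} \<Longrightarrow>
      f e \<le> 1 / (real (max (mdeg E ends u) (mdeg E ends v)) + real (edge_mult E ends u v))"
  shows "(\<Sum>e | e \<in> E \<and> v \<in> ends e. f e) \<le> 1"
proof -
  have "f e \<le> 1 / real (mdeg E ends v)" if e: "e \<in> E" "v \<in> ends e" for e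
  proof -
    obtain u where u: "ends e = {v, u}"
      using card_ends[OF e(1)] e(2) by (metis card_2_iff insertE insert_commute singletonD)
    have "0 < mdeg E ends v"
      using e finite_edges by (auto simp: mdeg_def card_gt_0_iff)
    then have "1 / (real (max (mdeg E ends v) (mdeg E ends u)) + real (edge_mult E ends v u))
        \<le> 1 / real (mdeg E ends v)"
      by (intro divide_left_mono mult_pos_pos) auto
    then show ?thesis using demand[OF e(1) u] by linarith
  qed
  then have "(\<Sum>e | e \<in> E \<and> v \<in> ends e. f e) \<le> (\<Sum>e | e \<in> E \<and> v \<in> ends e. 1 / real (mdeg E ends v))"
    by (intro sum_mono) auto
  also have "\<dots> \<le> 1" by (simp add: mdeg_def)
  finally show ?thesis .
qed

end

theorem theorem1p8:
  fixes V :: "'v set" and E :: "'e set" and ends :: "'e \<Rightarrow> 'v set" and f :: "'e \<Rightarrow> real"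
  assumes "loopless_multigraph V E ends"
    and "demand_function E f"
    and "\<And>e u v. e \<in> E \<Longrightarrow> ends e = {u, v} \<Longrightarrow>
           f e \<le> 1 / (real (max (mdeg E ends u) (mdeg E ends v)) + real (edge_mult E ends u v))"
  shows "\<exists>\<phi>. f_coloring E (line_adj E ends) f \<phi>"
proof -
  interpret multigraph E ends
    using assms(1) by unfold_locales (auto simp: loopless_multigraph_def)
  have nonneg: "0 \<le> f e" if "e \<in> E" for e
    using assms(2) that by (simp add: demand_function_def)
  have vertex: "(\<Sum>e | e \<in> E \<and> v \<in> ends e. f e) \<le> 1" for v
    by (rule demand_at_vertex_le) (rule assms(3))
  have subgraph: "(\<Sum>e\<in>inside E S. f e) \<le> (real (card S) - 1) / 2" if "finite S" "S \<noteq> {}" for S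
    by (rule demand_inside_le[OF _ that]) (rule assms(3))
  show ?thesis
  proof (rule matching_decomposition[OF nonneg vertex subgraph])
    fix l :: "'e set \<Rightarrow> real"
    assume "\<And>M. matching M \<Longrightarrow> 0 \<le> l M" "(\<Sum>M | matching M. l M) = 1"
      "\<And>e. e \<in> E \<Longrightarrow> f e = (\<Sum>M | matching M \<and> e \<in> M. l M)"
    then show ?thesis by (rule coloring_of_matching_decomposition)
  qed
qed

end
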